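(* For every integer $n\geq 2$ and every integer $b\in\{1,\dots,n-1\}$, there exists a connected irreducible graph of order $n$ and metric dimension $b$.
   Context: Graphs are finite, simple and undirected; the order of a graph is its number of vertices; $d_G(x,y)$ is the distance between $x$ and $y$ in $G$. A vertex $w$ resolves a pair of vertices $u,v$ if $d_G(u,w)\neq d_G(v,w)$. A set $W\subseteq V(G)$ is a resolving set for $G$ if every pair of distinct vertices of $G$ is resolved by some vertex of $W$. The metric dimension $\beta(G)$ is the minimum cardinality of a resolving set for $G$ (with $\beta(K_1)=0$). The threshold dimension is $\tau(G)=\min\{\beta(H): H \text{ contains } G \text{ as a spanning subgraph}\}$, i.e. the minimum metric dimension among all graphs $H$ with $V(H)=V(G)$ and $E(G)\subseteq E(H)$. A graph $G$ is irreducible if $\tau(G)=\beta(G)$. *)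

theory Defs
  imports "Graph_Theory.Graph_Theory"
begin

text \<open>
  Finite simple undirected graphs are the \<open>pair_graph\<close>s of the Graph\_Theory library: an undirected
  edge is the pair of arcs \<open>(u, v)\<close>, \<open>(v, u)\<close>, and there are no loops or parallel arcs.

  The distance is the length of a shortest walk, i.e. the library's weighted distance for the
  weight 1 on every arc. It is \<open>\<infinity>\<close> between different components.
\<close>

definition graph_dist :: "'a pair_pre_digraph \<Rightarrow> 'a \<Rightarrow> 'a \<Rightarrow> ereal" where
  "graph_dist G u v = wf_digraph.\<mu> (with_proj G) (\<lambda>_. 1) u v"

definition resolves :: "'a pair_pre_digraph \<Rightarrow> 'a \<Rightarrow> 'a \<Rightarrow> 'a \<Rightarrow> bool" where
  "resolves G w u v \<longleftrightarrow> graph_dist G u w \<noteq> graph_dist G v w"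

definition resolving_set :: "'a pair_pre_digraph \<Rightarrow> 'a set \<Rightarrow> bool" where
  "resolving_set G W \<longleftrightarrow> W \<subseteq> pverts G \<and>
     (\<forall>u\<in>pverts G. \<forall>v\<in>pverts G. u \<noteq> v \<longrightarrow> (\<exists>w\<in>W. resolves G w u v))"

definition metric_dimension :: "'a pair_pre_digraph \<Rightarrow> nat" where
  "metric_dimension G = (LEAST k. \<exists>W. resolving_set G W \<and> card W = k)"

definition threshold_dimension :: "'a pair_pre_digraph \<Rightarrow> nat" where
  "threshold_dimension G =
     (LEAST k. \<exists>H. pair_graph H \<and> spanning (with_proj G) (with_proj H) \<and> metric_dimension H = k)"

definition irreducible_graph :: "'a pair_pre_digraph \<Rightarrow> bool" where
  "irreducible_graph G \<longleftrightarrow> threshold_dimension G = metric_dimension G"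

text \<open>The two least elements above are attained minima.\<close>

lemma graph_dist_eq:
  assumes "pair_graph G"
  shows "graph_dist G u v =
    (INF p\<in>{p. pre_digraph.awalk (with_proj G) u p v}. ereal (real (length p)))"
proof -
  interpret pair_graph G by fact
  have "awalk_cost (\<lambda>_. 1) p = real (length p)" for p :: "('a \<times> 'a) list"
    by (induction p) auto
  then show ?thesis by (simp add: graph_dist_def \<mu>_def)
qed

lemma graph_dist_self:
  assumes "pair_graph G" and "u \<in> pverts G"
  shows "graph_dist G u u = 0"
proof -
  interpret pair_graph G by fact
  have "graph_dist G u u \<le> 0"
    unfolding graph_dist_eq[OF assms(1)]
    by (rule INF_lower2[of "[]"]) (use assms in \<open>auto simp: awalk_Nil_iff\<close>)
  moreover have "graph_dist G u u \<ge> 0"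
    unfolding graph_dist_eq[OF assms(1)] by (rule INF_greatest) auto
  ultimately show ?thesis by simp
qed

lemma graph_dist_pos:
  assumes "pair_graph G" and "u \<noteq> v"
  shows "graph_dist G u v \<ge> 1"
proof -
  interpret pair_graph G by fact
  have "(1::ereal) \<le> ereal (real (length p))" if "awalk u p v" for p
  proof -
    have "p \<noteq> []" using that assms by (auto simp: awalk_Nil_iff)
    then have "1 \<le> real (length p)" by (cases p) auto
    then show ?thesis by simp
  qed
  then show ?thesis
    unfolding graph_dist_eq[OF assms(1)] by (intro INF_greatest) blast
qed

lemma metric_dimension_attained:
  assumes "pair_graph G"
  obtains W where "resolving_set G W" and "card W = metric_dimension G"
proof -
  have "resolving_set G (pverts G)"
    unfolding resolving_set_def resolves_def
  proof (intro conjI ballI impI)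
    fix u v assume "u \<in> pverts G" "v \<in> pverts G" "u \<noteq> v"
    then have "graph_dist G u u \<noteq> graph_dist G v u"
      using graph_dist_self[OF assms, of u] graph_dist_pos[OF assms, of v u] by auto
    then show "\<exists>w\<in>pverts G. graph_dist G u w \<noteq> graph_dist G v w"
      using \<open>u \<in> pverts G\<close> by blast
  qed simp
  then have "\<exists>k W. resolving_set G W \<and> card W = k" by blast
  then show thesis
    using LeastI_ex[of "\<lambda>k. \<exists>W. resolving_set G W \<and> card W = k"] that
    unfolding metric_dimension_def by blast
qed

lemma threshold_dimension_attained:
  assumes "pair_graph G"
  obtains H where "pair_graph H" and "spanning (with_proj G) (with_proj H)"
    and "metric_dimension H = threshold_dimension G"
proof -
  interpret pair_graph G by fact
  have "spanning (with_proj G) (with_proj G)"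
    using wf_digraph by (auto simp: spanning_def subgraph_def compatible_def)
  then have "\<exists>k H. pair_graph H \<and> spanning (with_proj G) (with_proj H) \<and> metric_dimension H = k"
    using assms by blast
  then show thesis
    using LeastI_ex[of "\<lambda>k. \<exists>H. pair_graph H \<and> spanning (with_proj G) (with_proj H)
      \<and> metric_dimension H = k"] that
    unfolding threshold_dimension_def by blast
qed

lemma spanning_pair_graph_iff:
  assumes "pair_graph G" and "pair_graph H"
  shows "spanning (with_proj G) (with_proj H) \<longleftrightarrow> pverts G = pverts H \<and> parcs G \<subseteq> parcs H"
proof -
  interpret G: pair_graph G by fact
  interpret H: pair_graph H by fact
  show ?thesis
    using G.wf_digraph H.wf_digraph
    by (auto simp: spanning_def subgraph_def compatible_def)
qed

end

theory Submission
  imports Defs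
begin

text \<open>
  A clique with \<open>2 ^ b\<close> vertices forces the metric dimension to be at least \<open>b\<close>, since the
  distances from the clique to a fixed vertex take at most two values. If \<open>n \<ge> b + 2 ^ b\<close>, take
  independent vertices \<open>w\<^sub>1, \<dots>, w\<^sub>b\<close>, a clique of \<open>2 ^ b\<close> vertices whose neighbourhoods in the
  \<open>w\<^sub>i\<close> are all the subsets, and a path attached to the clique vertex without neighbours among the
  \<open>w\<^sub>i\<close>. The \<open>w\<^sub>i\<close> resolve this graph.

  If \<open>n < b + 2 ^ b\<close>, the same pattern without the path, and with some clique vertices omitted,
  gives a graph of dimension at most \<open>b\<close> with a universal vertex. In the presence of a universal
  vertex all distances are at most 2, and therefore a new edge raises the dimension by at most one.
  As the complete graph has dimension \<open>n - 1 \<ge> b\<close>, an edge-maximal supergraph of dimension at most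
  \<open>b\<close> has dimension exactly \<open>b\<close> and is irreducible.
\<close>

section \<open>Distances\<close>

lemma pair_graphI:
  assumes "finite V" "E \<subseteq> V \<times> V" "sym E" "\<And>v. (v, v) \<notin> E"
  shows "pair_graph \<lparr>pverts = V, parcs = E\<rparr>"
proof
  show "finite (parcs \<lparr>pverts = V, parcs = E\<rparr>)"
    using assms(1,2) by (auto intro: finite_subset)
qed (use assms in \<open>auto simp: symmetric_def\<close>)

lemma pair_graph_symD:
  assumes "pair_graph G" "(u, v) \<in> parcs G"
  shows "(v, u) \<in> parcs G"
proof -
  interpret pair_graph G by fact
  show ?thesis using pair_sym_arcs assms(2) by (auto simp: symmetric_def dest: symD)
qed

lemma graph_dist_le_length:
  assumes "pair_graph G" "pre_digraph.awalk (with_proj G) u p v"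
  shows "graph_dist G u v \<le> ereal (real (length p))"
  unfolding graph_dist_eq[OF assms(1)] by (rule INF_lower) (use assms(2) in simp)

text \<open>Walk lengths are natural numbers, so the infimum is attained unless there is no walk at
  all.\<close>

lemma graph_dist_cases:
  assumes "pair_graph G"
  obtains (unreachable) "graph_dist G u v = \<infinity>"
  | (walk) p where "pre_digraph.awalk (with_proj G) u p v"
      "graph_dist G u v = ereal (real (length p))"
proof (cases "\<exists>p. pre_digraph.awalk (with_proj G) u p v")
  case False
  then have "graph_dist G u v = \<infinity>"
    unfolding graph_dist_eq[OF assms] by (simp add: top_ereal_def)
  then show thesis by (rule unreachable)
next
  case True
  then obtain p where p: "pre_digraph.awalk (with_proj G) u p v"
    and min: "\<And>q. pre_digraph.awalk (with_proj G) u q v \<Longrightarrow> length p \<le> length q"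
    using ex_has_least_nat[of "\<lambda>p. pre_digraph.awalk (with_proj G) u p v" _ length] by blast
  have "graph_dist G u v \<ge> ereal (real (length p))"
    unfolding graph_dist_eq[OF assms] by (rule INF_greatest) (use min in auto)
  then show thesis
    using walk[OF p] graph_dist_le_length[OF assms p] by simp
qed

lemma graph_dist_arc_le:
  assumes "pair_graph G" "(u, v) \<in> parcs G"
  shows "graph_dist G u w \<le> graph_dist G v w + 1"
  using assms(1)
proof (cases rule: graph_dist_cases[of _ v w])
  case unreachable
  then show ?thesis by simp
next
  case (walk p)
  interpret pair_graph G by fact
  have "awalk u ((u, v) # p) w"
    using walk(1) assms(2) by (simp add: awalk_Cons_iff)
  from graph_dist_le_length[OF assms(1) this] show ?thesis
    using walk(2) by (simp add: add.commute)
qed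

text \<open>Each arc lowers \<open>f\<close> by at most 1, so a walk from \<open>v\<close> to
  \<open>w\<close> has at least \<open>f v\<close> arcs; following the descent from \<open>v\<close>
  gives one with exactly \<open>f v\<close>.\<close>

lemma graph_dist_eq_potential:
  assumes G: "pair_graph G" and "v \<in> pverts G" and "w \<in> pverts G" and "f w = 0"
    and lipschitz: "\<And>u u'. (u, u') \<in> parcs G \<Longrightarrow> f u \<le> Suc (f u')"
    and descent: "\<And>u. u \<in> pverts G \<Longrightarrow> u \<noteq> w \<Longrightarrow> \<exists>u'. (u, u') \<in> parcs G \<and> f u = Suc (f u')"
  shows "graph_dist G v w = ereal (real (f v))"
proof (rule antisym)
  interpret pair_graph G by fact
  have "\<exists>p. awalk v p w \<and> length p = f v"
    using assms(2)
  proof (induction "f v" arbitrary: v)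
    case 0
    then have "v = w" using descent[of v] by auto
    then show ?case using 0 by (intro exI[of _ "[]"]) (simp add: awalk_Nil_iff)
  next
    case (Suc k)
    then have "v \<noteq> w" using \<open>f w = 0\<close> by auto
    then obtain u where u: "(v, u) \<in> parcs G" "f v = Suc (f u)"
      using descent Suc.prems by blast
    then obtain p where "awalk u p w" "length p = f u"
      using Suc.hyps(1)[of u] Suc.hyps(2) in_arcsD2 by auto
    then show ?case
      using u by (intro exI[of _ "(v, u) # p"]) (simp add: awalk_Cons_iff)
  qed
  then show "graph_dist G v w \<le> ereal (real (f v))"
    using graph_dist_le_length[OF G] by force
next
  interpret pair_graph G by fact
  have "f u \<le> length p" if "awalk u p w" for u p
    using that
  proof (induction p arbitrary: u)
    case Nil
    then show ?case using \<open>f w = 0\<close> by (simp add: awalk_Nil_iff)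
  next
    case (Cons e p)
    then have e: "e \<in> parcs G" "u = fst e" "awalk (snd e) p w"
      by (simp_all add: awalk_Cons_iff)
    then have "f u \<le> Suc (f (snd e))"
      using lipschitz[of u "snd e"] by (cases e) simp
    then show ?case using Cons.IH[OF e(3)] by simp
  qed
  then show "ereal (real (f v)) \<le> graph_dist G v w"
    unfolding graph_dist_eq[OF G] by (intro INF_greatest) auto
qed

text \<open>Walks to \<open>r\<close> can be reversed because the arcs are symmetric, so any two
  vertices are joined through \<open>r\<close>.\<close>

lemma connected_if_finite_dist:
  assumes G: "pair_graph G" and "r \<in> pverts G"
    and fin: "\<And>v. v \<in> pverts G \<Longrightarrow> graph_dist G v r \<noteq> \<infinity>"
  shows "connected (with_proj G)"
proof -
  interpret pair_graph G by fact
  have r: "v \<rightarrow>\<^sup>*\<^bsub>with_proj G\<^esub> r" if "v \<in> pverts G" for v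
    using G
  proof (cases rule: graph_dist_cases[of _ v r])
    case unreachable
    then show ?thesis using fin[OF that] by simp
  next
    case (walk p)
    from walk(1) show ?thesis unfolding reachable_awalk by (rule exI)
  qed
  show ?thesis
    unfolding connected_def
  proof (rule strongly_connectedI)
    fix u v
    assume "u \<in> verts (with_proj (mk_symmetric (with_proj G)))"
      "v \<in> verts (with_proj (mk_symmetric (with_proj G)))"
    then have "u \<rightarrow>\<^sup>*\<^bsub>with_proj G\<^esub> r" "r \<rightarrow>\<^sup>*\<^bsub>with_proj G\<^esub> v"
      using r symmetric_reachable[OF sym_arcs] by auto
    then have "u \<rightarrow>\<^sup>*\<^bsub>with_proj G\<^esub> v" by (rule reachable_trans)
    then show "u \<rightarrow>\<^sup>*\<^bsub>with_proj (mk_symmetric (with_proj G))\<^esub> v" by (rule reachable_mk_symmetricI)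
  qed (use \<open>r \<in> pverts G\<close> in auto)
qed

section \<open>Metric dimension and threshold dimension\<close>

lemma resolving_set_finite:
  assumes "pair_graph G" "resolving_set G W"
  shows "finite W"
proof -
  interpret pair_graph G by fact
  show ?thesis
    using assms(2) pair_finite_verts by (auto simp: resolving_set_def intro: finite_subset)
qed

lemma metric_dimension_le_card:
  "resolving_set G W \<Longrightarrow> metric_dimension G \<le> card W"
  unfolding metric_dimension_def by (rule Least_le) blast

lemma resolving_setE:
  assumes "resolving_set G W" "u \<in> pverts G" "v \<in> pverts G" "u \<noteq> v"
  obtains w where "w \<in> W" "w \<in> pverts G" "graph_dist G u w \<noteq> graph_dist G v w"
  using assms unfolding resolving_set_def resolves_def by blast

lemma resolves_self:
  assumes "pair_graph G" "u \<in> pverts G" "u \<noteq> v"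
  shows "resolves G u u v" "resolves G u v u"
  using graph_dist_self[OF assms(1,2)] graph_dist_pos[of G v u] assms
  by (auto simp: resolves_def)

text \<open>A vertex of \<open>W\<close> has distance 0 to itself and at least 1 from any other
  vertex, so only pairs outside \<open>W\<close> need checking.\<close>

lemma resolving_setI:
  assumes "pair_graph G" "W \<subseteq> pverts G"
    and "\<And>u v. u \<in> pverts G - W \<Longrightarrow> v \<in> pverts G - W \<Longrightarrow> u \<noteq> v \<Longrightarrow> \<exists>w\<in>W. resolves G w u v"
  shows "resolving_set G W"
  unfolding resolving_set_def
proof (intro conjI ballI impI assms(2))
  fix u v assume uv: "u \<in> pverts G" "v \<in> pverts G" "u \<noteq> v"
  consider "u \<in> W" | "v \<in> W" | "u \<in> pverts G - W" "v \<in> pverts G - W"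
    using uv by blast
  then show "\<exists>w\<in>W. resolves G w u v"
  proof cases
    case 1
    then show ?thesis using resolves_self(1)[OF assms(1), of u v] uv by (intro bexI[of _ u])
  next
    case 2
    then show ?thesis using resolves_self(2)[OF assms(1), of v u] uv by (intro bexI[of _ v]) auto
  next
    case 3
    then show ?thesis using assms(3) uv(3) by blast
  qed
qed

lemma irreducible_graphI:
  assumes G: "pair_graph G"
    and "\<And>H. pair_graph H \<Longrightarrow> pverts H = pverts G \<Longrightarrow> parcs G \<subseteq> parcs H
      \<Longrightarrow> metric_dimension G \<le> metric_dimension H"
  shows "irreducible_graph G"
proof -
  have "threshold_dimension G \<le> metric_dimension G"
    unfolding threshold_dimension_def
    by (rule Least_le) (use G spanning_pair_graph_iff in blast)
  moreover obtain H where "pair_graph H" "spanning (with_proj G) (with_proj H)"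
    "metric_dimension H = threshold_dimension G"
    by (rule threshold_dimension_attained[OF G])
  ultimately show ?thesis
    using assms(2)[of H] spanning_pair_graph_iff[OF G, of H] by (simp add: irreducible_graph_def)
qed

lemma clique_card_le:
  assumes G: "pair_graph G" and C: "C \<subseteq> pverts G"
    and clique: "\<And>u v. u \<in> C \<Longrightarrow> v \<in> C \<Longrightarrow> u \<noteq> v \<Longrightarrow> (u, v) \<in> parcs G"
  shows "card C \<le> 2 ^ metric_dimension G"
proof (cases "C = {}")
  case False
  interpret pair_graph G by fact
  obtain W where W: "resolving_set G W" "card W = metric_dimension G"
    by (rule metric_dimension_attained[OF G])
  have "finite W" using resolving_set_finite[OF G W(1)] .
  have "finite C" using C pair_finite_verts by (rule finite_subset)
  define m where "m w = Min ((\<lambda>c. graph_dist G c w) ` C)" for w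
  have m_le: "m w \<le> graph_dist G c w" if "c \<in> C" for c w
    unfolding m_def using that \<open>finite C\<close> by simp
  have two_values: "graph_dist G c w = m w + 1" if "c \<in> C" "graph_dist G c w \<noteq> m w" for c w
  proof -
    have "m w \<in> (\<lambda>c. graph_dist G c w) ` C"
      unfolding m_def using \<open>finite C\<close> False by (intro Min_in) auto
    then obtain c0 where c0: "c0 \<in> C" "m w = graph_dist G c0 w" by blast
    have "(c, c0) \<in> parcs G" using clique that c0 by auto
    from graph_dist_arc_le[OF G this, of w] m_le[OF that(1), of w] that(2) c0(2)
    have *: "m w < graph_dist G c w" "graph_dist G c w \<le> m w + 1" by auto
    \<comment> \<open>In \<open>ereal\<close> the bounds in \<open>*\<close> leave room for
      non-integral values; they force both distances to be finite walk lengths, and these differ by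
      exactly 1.\<close>
    show ?thesis
      using G
    proof (cases rule: graph_dist_cases[of _ c0 w])
      case unreachable
      then show ?thesis using * c0 by simp
    next
      case 1: (walk p)
      show ?thesis
        using G
      proof (cases rule: graph_dist_cases[of _ c w])
        case unreachable
        then show ?thesis using * 1 c0 by simp
      next
        case (walk q)
        then have "length q = Suc (length p)" using * 1 c0 by simp
        then show ?thesis using walk 1 c0 by simp
      qed
    qed
  qed
  \<comment> \<open>With only the values \<open>m w\<close> and \<open>m w + 1\<close> available,
    \<open>trace c\<close> encodes all distances from \<open>c\<close> to \<open>W\<close>; as
    \<open>W\<close> resolves, it determines \<open>c\<close>.\<close>
  define trace where "trace c = {w \<in> W. graph_dist G c w = m w}" for c
  have "inj_on trace C"
  proof (rule inj_onI, rule ccontr)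
    fix c c' assume c: "c \<in> C" "c' \<in> C" "trace c = trace c'" "c \<noteq> c'"
    then obtain w where "w \<in> W" "graph_dist G c w \<noteq> graph_dist G c' w"
      using resolving_setE[OF W(1), of c c'] C by blast
    moreover from this have "graph_dist G c w = m w \<longleftrightarrow> graph_dist G c' w = m w"
      using c(3) by (auto simp: trace_def)
    ultimately show False using two_values c(1,2) by metis
  qed
  moreover have "trace ` C \<subseteq> Pow W" by (auto simp: trace_def)
  ultimately have "card C \<le> card (Pow W)"
    using \<open>finite W\<close> by (intro card_inj_on_le) auto
  then show ?thesis using W(2) \<open>finite W\<close> by (simp add: card_Pow)
qed simp

section \<open>Graphs with a universal vertex\<close>

locale universal_vertex = pair_graph G for G :: "'a pair_pre_digraph" +
  fixes c :: 'a
  assumes center_in_verts: "c \<in> pverts G"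
    and center_adjacent: "v \<in> pverts G \<Longrightarrow> v \<noteq> c \<Longrightarrow> (v, c) \<in> parcs G"
begin

lemma graph_dist_universal:
  assumes "v \<in> pverts G" "w \<in> pverts G"
  shows "graph_dist G v w = (if v = w then 0 else if (v, w) \<in> parcs G then 1 else 2)"
proof -
  define f :: "'a \<Rightarrow> nat" where
    "f v = (if v = w then 0 else if (v, w) \<in> parcs G then 1 else 2)" for v
  have cw: "(c, w) \<in> parcs G" if "c \<noteq> w"
    using center_adjacent[of w] pair_graph_symD[OF pair_graph] assms that by auto
  have "graph_dist G v w = ereal (real (f v))"
  proof (rule graph_dist_eq_potential[OF pair_graph assms])
    fix u assume u: "u \<in> pverts G" "u \<noteq> w"
    show "\<exists>u'. (u, u') \<in> parcs G \<and> f u = Suc (f u')"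
    proof (cases "(u, w) \<in> parcs G")
      case True
      then show ?thesis using u by (intro exI[of _ w]) (auto simp: f_def)
    next
      case False
      then have "u \<noteq> c" "c \<noteq> w" using cw center_adjacent u by auto
      then show ?thesis
        using False u cw center_adjacent by (intro exI[of _ c]) (auto simp: f_def)
    qed
  qed (auto simp: f_def)
  then show ?thesis by (auto simp: f_def)
qed

text \<open>Makes the distance formula available in every supergraph on the same vertices.\<close>

lemma universal_supergraph:
  assumes "pair_graph H" "pverts H = pverts G" "parcs G \<subseteq> parcs H"
  shows "universal_vertex H c"
  unfolding universal_vertex_def universal_vertex_axioms_def
  using assms center_in_verts center_adjacent by auto

lemma connected_universal: "connected (with_proj G)"
  by (rule connected_if_finite_dist[OF pair_graph center_in_verts])
    (simp add: graph_dist_universal center_in_verts)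

text \<open>All vertices outside \<open>W\<close> are at distance 1 from each vertex of
  \<open>W\<close>, so at most one vertex can be left out.\<close>

lemma metric_dimension_complete:
  assumes "\<And>u v. u \<in> pverts G \<Longrightarrow> v \<in> pverts G \<Longrightarrow> u \<noteq> v \<Longrightarrow> (u, v) \<in> parcs G"
  shows "card (pverts G) - 1 \<le> metric_dimension G"
proof -
  obtain W where W: "resolving_set G W" "card W = metric_dimension G"
    by (rule metric_dimension_attained[OF pair_graph])
  have fin: "finite W" using resolving_set_finite[OF pair_graph W(1)] .
  have "u = v" if uv: "u \<in> pverts G - W" "v \<in> pverts G - W" for u v
  proof (rule ccontr)
    assume "u \<noteq> v"
    then obtain w where w: "w \<in> W" "w \<in> pverts G" "graph_dist G u w \<noteq> graph_dist G v w"
      using resolving_setE[OF W(1), of u v] uv by blast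
    have "graph_dist G z w = 1" if "z \<in> pverts G - W" for z
    proof -
      have "z \<noteq> w" using that w(1) by blast
      then have "(z, w) \<in> parcs G" using that w(2) by (intro assms) auto
      then show ?thesis using that w(2) \<open>z \<noteq> w\<close> by (simp add: graph_dist_universal)
    qed
    then show False using uv w(3) by simp
  qed
  then have "card (pverts G - W) \<le> 1"
    using pair_finite_verts by (subst card_le_Suc0_iff_eq[unfolded One_nat_def[symmetric]]) auto
  moreover have "card (pverts G - W) = card (pverts G) - card W"
    using W(1) fin by (intro card_Diff_subset) (auto simp: resolving_set_def)
  ultimately show ?thesis using W(2) by simp
qed

text \<open>Adjacency determines all distances here, so the new edge can change only the distance
  between \<open>x\<close> and \<open>y\<close>; one further landmark, an endpoint of the edge,
  makes up for this.\<close>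

lemma metric_dimension_add_edge:
  assumes x: "x \<in> pverts G" and y: "y \<in> pverts G" and "x \<noteq> y"
  defines "H \<equiv> \<lparr>pverts = pverts G, parcs = parcs G \<union> {(x, y), (y, x)}\<rparr>"
  shows "pair_graph H" "metric_dimension H \<le> Suc (metric_dimension G)"
proof -
  show H: "pair_graph H"
    unfolding H_def
  proof (rule pair_graphI)
    show "sym (parcs G \<union> {(x, y), (y, x)})"
      using pair_graph_symD[OF pair_graph] by (auto simp: sym_def)
    show "parcs G \<union> {(x, y), (y, x)} \<subseteq> pverts G \<times> pverts G"
      using x y in_arcsD1 in_arcsD2 by auto
    show "(v, v) \<notin> parcs G \<union> {(x, y), (y, x)}" for v
      using pair_no_loops[of "(v, v)"] \<open>x \<noteq> y\<close> by auto
  qed (rule pair_finite_verts)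
  interpret H: universal_vertex H c
    by (rule universal_supergraph[OF H]) (auto simp: H_def)
  obtain W where W: "resolving_set G W" "card W = metric_dimension G"
    by (rule metric_dimension_attained[OF pair_graph])
  have W_sub: "W \<subseteq> pverts G" using W(1) by (simp add: resolving_set_def)
  define z where "z = (if x \<in> W then y else x)"
  \<comment> \<open>This choice of \<open>z\<close> ensures that the new edge does not join \<open>W\<close> to the outside of
    \<open>insert z W\<close>.\<close>
  have new_edge: "(u, w) \<in> parcs H \<longleftrightarrow> (u, w) \<in> parcs G" if "u \<notin> insert z W" "w \<in> W" for u w
    using that by (auto simp: H_def z_def split: if_splits)
  have "resolving_set H (insert z W)"
  proof (rule resolving_setI[OF H])
    show "insert z W \<subseteq> pverts H" using W_sub x y by (auto simp: z_def H_def)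
    fix u v assume uv: "u \<in> pverts H - insert z W" "v \<in> pverts H - insert z W" "u \<noteq> v"
    have verts: "pverts H = pverts G" by (simp add: H_def)
    obtain w where w: "w \<in> W" "graph_dist G u w \<noteq> graph_dist G v w"
      using resolving_setE[OF W(1), of u v] uv unfolding verts by blast
    have "graph_dist H u w = graph_dist G u w" "graph_dist H v w = graph_dist G v w"
      using uv w W_sub new_edge by (auto simp: verts graph_dist_universal H.graph_dist_universal)
    then show "\<exists>w\<in>insert z W. resolves H w u v"
      using w by (intro bexI[of _ w]) (simp_all add: resolves_def)
  qed
  then have "metric_dimension H \<le> card (insert z W)" by (rule metric_dimension_le_card)
  also have "\<dots> \<le> Suc (card W)" by (rule card_insert_le_m1) auto
  finally show "metric_dimension H \<le> Suc (metric_dimension G)" using W(2) by simp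
qed

lemma irreducible_supergraph:
  assumes "metric_dimension G \<le> b" "b \<le> card (pverts G) - 1"
  obtains H where "universal_vertex H c" "pverts H = pverts G" "irreducible_graph H"
    "metric_dimension H = b"
proof -
  define P where "P H \<longleftrightarrow> pair_graph H \<and> pverts H = pverts G \<and> parcs G \<subseteq> parcs H \<and>
    metric_dimension H \<le> b" for H
  have bounded: "card (parcs H) \<le> card (pverts G \<times> pverts G)" if "P H" for H
  proof -
    interpret H: pair_graph H using that by (simp add: P_def)
    have "parcs H \<subseteq> pverts G \<times> pverts G"
      using that H.in_arcsD1 H.in_arcsD2 by (auto simp: P_def)
    then show ?thesis
      using pair_finite_verts by (intro card_mono) auto
  qed
  have "P G" using assms(1) pair_graph by (simp add: P_def)
  then have "\<exists>H. P H \<and> (\<forall>H'. P H' \<longrightarrow> card (parcs H') \<le> card (parcs H))"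
    by (rule ex_has_greatest_nat[where b = "Suc (card (pverts G \<times> pverts G))"])
      (use bounded in \<open>auto simp: less_Suc_eq_le\<close>)
  then obtain H where PH: "P H" and max: "\<And>H'. P H' \<Longrightarrow> card (parcs H') \<le> card (parcs H)"
    by blast
  interpret H: universal_vertex H c
    by (rule universal_supergraph) (use PH in \<open>auto simp: P_def\<close>)
  \<comment> \<open>Maximality of \<open>H\<close> in this form gives irreducibility as soon as the
    dimension of \<open>H\<close> is known to be \<open>b\<close>.\<close>
  have larger: "b < metric_dimension H'"
    if "pair_graph H'" "pverts H' = pverts H" "parcs H \<subset> parcs H'" for H'
  proof (rule ccontr)
    interpret H': pair_graph H' by fact
    assume "\<not> b < metric_dimension H'"
    then have "P H'" using PH that by (auto simp: P_def)
    then show False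
      using max[of H'] psubset_card_mono[OF H'.pair_finite_arcs that(3)] by simp
  qed
  have "b \<le> metric_dimension H"
  proof (cases "\<exists>x y. x \<in> pverts H \<and> y \<in> pverts H \<and> x \<noteq> y \<and> (x, y) \<notin> parcs H")
    case True
    then obtain x y where xy: "x \<in> pverts H" "y \<in> pverts H" "x \<noteq> y" "(x, y) \<notin> parcs H"
      by blast
    \<comment> \<open>Adding \<open>xy\<close> pushes the dimension above \<open>b\<close> but
      raises it by at most 1, so it was already at least \<open>b\<close>.\<close>
    note add = H.metric_dimension_add_edge[OF xy(1-3)]
    show ?thesis using larger[OF add(1)] add(2) xy(4) by force
  next
    case False
    then have "card (pverts H) - 1 \<le> metric_dimension H"
      by (intro H.metric_dimension_complete) blast
    then show ?thesis using assms(2) PH by (simp add: P_def)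
  qed
  then have dim: "metric_dimension H = b" using PH by (simp add: P_def)
  have "irreducible_graph H"
  proof (rule irreducible_graphI[OF H.pair_graph])
    fix H' assume H': "pair_graph H'" "pverts H' = pverts H" "parcs H \<subseteq> parcs H'"
    show "metric_dimension H \<le> metric_dimension H'"
    proof (cases "parcs H' = parcs H")
      case True
      then have "H' = H" using H'(2) by (intro pair_pre_digraph.equality) auto
      then show ?thesis by simp
    next
      case False
      then have "parcs H \<subset> parcs H'" using H'(3) by blast
      then show ?thesis using larger[OF H'(1,2)] dim by simp
    qed
  qed
  then show thesis
    using that[of H] dim PH H.universal_vertex_axioms by (auto simp: P_def)
qed

end

section \<open>The construction\<close>

text \<open>
  The vertices below \<open>b\<close> are the \<open>w\<^sub>i\<close>, the vertices \<open>b + s\<close> with \<open>s < 2 ^ b\<close> form the clique,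
  with \<open>w\<^sub>i\<close> adjacent to \<open>b + s\<close> when bit \<open>i\<close> of \<open>s\<close> is not set, and the remaining vertices form the path.
  \<open>height b i v\<close> is the distance from \<open>v\<close> to \<open>w\<^sub>i\<close>, and two vertices are adjacent whenever these
  distances permit it.
\<close>

definition height :: "nat \<Rightarrow> nat \<Rightarrow> nat \<Rightarrow> nat" where
  "height b i v =
    (if v = i then 0 else if v < b then 2
     else if v < b + 2 ^ b then (if bit (v - b) i then 2 else 1)
     else v - (b + 2 ^ b) + 3)"

definition height_graph :: "nat \<Rightarrow> nat \<Rightarrow> nat pair_pre_digraph" where
  "height_graph b n = \<lparr>pverts = {..<n}, parcs = {(u, v). u < n \<and> v < n \<and> u \<noteq> v \<and>
    (\<forall>i<b. height b i u \<le> Suc (height b i v) \<and> height b i v \<le> Suc (height b i u))}\<rparr>"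

lemma pverts_height_graph [simp]: "pverts (height_graph b n) = {..<n}"
  by (simp add: height_graph_def)

lemma parcs_height_graph:
  "(u, v) \<in> parcs (height_graph b n) \<longleftrightarrow> u < n \<and> v < n \<and> u \<noteq> v \<and>
    (\<forall>i<b. height b i u \<le> Suc (height b i v) \<and> height b i v \<le> Suc (height b i u))"
  by (simp add: height_graph_def)

lemma pair_graph_height_graph: "pair_graph (height_graph b n)"
  unfolding height_graph_def by (rule pair_graphI) (auto simp: sym_def)

text \<open>The clique vertex with all bits set is adjacent to none of the vertices below
  \<open>b\<close>; the path, whose heights start at 3, is attached there.\<close>

lemma height_path_start:
  assumes "i < b"
  shows "height b i (b + 2 ^ b - 1) = 2"
proof -
  have "b + 2 ^ b - 1 - b = (mask b :: nat)" by (simp add: mask_eq_exp_minus_1)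
  moreover have "bit (mask b :: nat) i" using assms by (simp add: bit_mask_iff)
  moreover have "b \<le> b + 2 ^ b - 1" "b + 2 ^ b - 1 < b + 2 ^ b"
    using zero_less_power[of "2::nat" b] by linarith+
  ultimately show ?thesis using assms unfolding height_def by simp
qed

text \<open>The clique vertex with no bit set is adjacent to every vertex below \<open>b\<close>; it
  is the universal vertex when there is no path.\<close>

lemma height_center: "i < b \<Longrightarrow> height b i b = 1"
  by (simp add: height_def)

lemma height_clique: "b \<le> v \<Longrightarrow> v < b + 2 ^ b \<Longrightarrow> i < b \<Longrightarrow> height b i v \<in> {1, 2}"
  by (simp add: height_def)

text \<open>A shortest route to \<open>i\<close>: down the path to the clique, from height 2 to the
  center \<open>b\<close>, from height 1 directly to \<open>i\<close>. By \<open>b < n\<close> the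
  center is present even if the clique is truncated.\<close>

lemma height_descent:
  assumes "i < b" "b < n" "u < n" "u \<noteq> i"
  shows "\<exists>u'. (u, u') \<in> parcs (height_graph b n) \<and> height b i u = Suc (height b i u')"
proof -
  consider "u < b" | "b \<le> u" "u < b + 2 ^ b" "height b i u = 2"
    | "b \<le> u" "u < b + 2 ^ b" "height b i u = 1" | "u = b + 2 ^ b" | "b + 2 ^ b < u"
    using height_clique[of b u i] assms(1) by force
  then show ?thesis
  proof cases
    case 1
    then show ?thesis
      using assms by (intro exI[of _ b]) (auto simp: parcs_height_graph height_center, auto simp: height_def)
  next
    case 2
    have "height b k u \<in> {1, 2}" if "k < b" for k
      using height_clique[OF 2(1,2) that] .
    moreover have "u \<noteq> b" using 2(3) height_center[OF assms(1)] by auto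
    ultimately show ?thesis
      using assms 2 by (intro exI[of _ b]) (fastforce simp: parcs_height_graph height_center)
  next
    case 3
    have "height b k u \<in> {1, 2}" if "k < b" for k
      using height_clique[OF 3(1,2) that] .
    moreover have "height b k i = (if k = i then 0 else 2)" if "k < b" for k
      using assms by (simp add: height_def)
    ultimately show ?thesis
      using assms 3 by (intro exI[of _ i]) (fastforce simp: parcs_height_graph)
  next
    case 4
    have "height b k u = 3" if "k < b" for k
      using 4 that by (simp add: height_def)
    then show ?thesis
      using assms 4 height_path_start
      by (intro exI[of _ "b + 2 ^ b - 1"]) (auto simp: parcs_height_graph)
  next
    case 5
    have "height b k u = Suc (height b k (u - 1))" if "k < b" for k
      using 5 that by (auto simp: height_def)
    then show ?thesis
      using assms 5 by (intro exI[of _ "u - 1"]) (auto simp: parcs_height_graph)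
  qed
qed

text \<open>\<open>height b i\<close> is a potential: the Lipschitz condition is built into the
  adjacency of \<open>height_graph\<close>, and \<open>height_descent\<close> supplies the
  rest.\<close>

lemma graph_dist_height_graph:
  assumes "i < b" "b < n" "v < n"
  shows "graph_dist (height_graph b n) v i = ereal (real (height b i v))"
proof (rule graph_dist_eq_potential[OF pair_graph_height_graph])
  show "height b i i = 0" by (simp add: height_def)
qed (use assms height_descent in \<open>auto simp: parcs_height_graph\<close>)

lemma height_separates:
  assumes "u < v" "0 < b" "b \<le> u"
  shows "\<exists>i<b. height b i u \<noteq> height b i v"
proof (cases "v < b + 2 ^ b")
  case True
  \<comment> \<open>Numbers below \<open>2 ^ b\<close> are determined by their lowest
    \<open>b\<close> bits.\<close>
  have "\<exists>i<b. bit (u - b) i \<noteq> bit (v - b) i"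
  proof (rule ccontr)
    assume "\<not> ?thesis"
    then have "take_bit b (u - b) = take_bit b (v - b)"
      by (intro bit_eqI) (auto simp: bit_take_bit_iff)
    moreover have "u - b < 2 ^ b" "v - b < 2 ^ b" using True assms by auto
    ultimately show False using assms by (simp add: take_bit_nat_eq_self)
  qed
  then obtain i where "i < b" "bit (u - b) i \<noteq> bit (v - b) i" by blast
  then show ?thesis using True assms by (intro exI[of _ i]) (auto simp: height_def)
next
  case False
  \<comment> \<open>Now \<open>v\<close> is on the path, and coordinate 0 suffices: it is at most 2
    on the clique, and from 3 on it increases strictly along the path.\<close>
  then show ?thesis using assms by (intro exI[of _ 0]) (auto simp: height_def)
qed

lemma metric_dimension_height_graph_le:
  assumes "0 < b" "b < n"
  shows "metric_dimension (height_graph b n) \<le> b"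
proof -
  have "resolving_set (height_graph b n) {..<b}"
  proof (rule resolving_setI[OF pair_graph_height_graph])
    fix u v :: nat
    assume "u \<in> pverts (height_graph b n) - {..<b}" "v \<in> pverts (height_graph b n) - {..<b}" "u \<noteq> v"
    then have uv: "b \<le> u" "b \<le> v" "u < n" "v < n" "u < v \<or> v < u" by auto
    then obtain i where "i < b" "height b i u \<noteq> height b i v"
      using height_separates[of u v b] height_separates[of v u b] assms(1) by metis
    then show "\<exists>w\<in>{..<b}. resolves (height_graph b n) w u v"
      using uv assms(2) by (intro bexI[of _ i]) (auto simp: resolves_def graph_dist_height_graph)
  qed (use assms in auto)
  then show ?thesis using metric_dimension_le_card by fastforce
qed

lemma height_graph_clique:
  assumes "u \<in> {b..<b + 2 ^ b}" "v \<in> {b..<b + 2 ^ b}" "u < n" "v < n" "u \<noteq> v"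
  shows "(u, v) \<in> parcs (height_graph b n)"
proof -
  have "height b i u \<le> Suc (height b i v) \<and> height b i v \<le> Suc (height b i u)" if "i < b" for i
    using height_clique[of b u i] height_clique[of b v i] that assms by force
  then show ?thesis unfolding parcs_height_graph using assms by blast
qed

text \<open>The bound \<open>n \<le> b + 2 ^ b\<close> excludes path vertices, leaving only
  neighbours of the center.\<close>

lemma universal_vertex_height_graph:
  assumes "b < n" "n \<le> b + 2 ^ b"
  shows "universal_vertex (height_graph b n) b"
  unfolding universal_vertex_def universal_vertex_axioms_def
proof (intro conjI allI impI pair_graph_height_graph)
  fix v assume v: "v \<in> pverts (height_graph b n)" "v \<noteq> b"
  show "(v, b) \<in> parcs (height_graph b n)"
  proof (cases "v < b")
    case True
    then show ?thesis
      using v assms by (auto simp: parcs_height_graph height_center, auto simp: height_def)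
  next
    case False
    then show ?thesis using v assms by (intro height_graph_clique) auto
  qed
qed (use assms in simp)

theorem theorem4p6:
  fixes n b :: nat
  assumes "n \<ge> 2" and "b \<in> {1..n - 1}"
  shows "\<exists>G :: nat pair_pre_digraph.
    pair_graph G \<and> connected (with_proj G) \<and> irreducible_graph G \<and>
    card (pverts G) = n \<and> metric_dimension G = b"
proof -
  let ?G = "height_graph b n"
  have b: "0 < b" "b < n" using assms by auto
  note G = pair_graph_height_graph[of b n]
  note dim_le = metric_dimension_height_graph_le[OF b]
  show ?thesis
  proof (cases "n < b + 2 ^ b")
    case True
    then interpret universal_vertex ?G b
      using b by (intro universal_vertex_height_graph) auto
    obtain H where H: "universal_vertex H b" "pverts H = pverts ?G" "irreducible_graph H"
      "metric_dimension H = b"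
      by (rule irreducible_supergraph[OF dim_le]) (use b in auto)
    interpret H: universal_vertex H b by fact
    show ?thesis using H H.pair_graph H.connected_universal by auto
  next
    case False
    \<comment> \<open>The whole clique fits into \<open>?G\<close> and survives in every supergraph.
      Applied to \<open>?G\<close> itself this gives the dimension, and applied to supergraphs the
      irreducibility.\<close>
    have dim_ge: "b \<le> metric_dimension H"
      if H: "pair_graph H" "pverts H = pverts ?G" "parcs ?G \<subseteq> parcs H" for H
    proof -
      have "card {b..<b + 2 ^ b} \<le> 2 ^ metric_dimension H"
      proof (rule clique_card_le[OF H(1)])
        fix u v assume uv: "u \<in> {b..<b + 2 ^ b}" "v \<in> {b..<b + 2 ^ b}" "u \<noteq> v"
        then have "u < n" "v < n" using False by auto
        then show "(u, v) \<in> parcs H" using height_graph_clique[OF uv(1,2) _ _ uv(3)] H(3) by blast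
      next
        have "{b..<b + 2 ^ b} \<subseteq> {..<n}"
        proof
          fix v assume "v \<in> {b..<b + 2 ^ b}"
          then have "v < b + 2 ^ b" by simp
          with False show "v \<in> {..<n}" by simp
        qed
        then show "{b..<b + 2 ^ b} \<subseteq> pverts H" unfolding H(2) pverts_height_graph .
      qed
      then have "(2::nat) ^ b \<le> 2 ^ metric_dimension H" by simp
      then show ?thesis by (rule power_le_imp_le_exp[rotated]) simp
    qed
    have dim: "metric_dimension ?G = b" by (rule antisym[OF dim_le dim_ge[OF G]]) simp_all
    moreover have "irreducible_graph ?G"
      by (rule irreducible_graphI[OF G]) (unfold dim, rule dim_ge)
    \<comment> \<open>As \<open>0 < b\<close>, the vertex 0 is one of the landmarks, so its
      distances are the finite heights.\<close>
    moreover have "connected (with_proj ?G)"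
      using b by (intro connected_if_finite_dist[OF G, of 0]) (auto simp: graph_dist_height_graph)
    ultimately show ?thesis using G by (intro exI[of _ ?G]) auto
  qed
qed

end
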